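(* Let $d$ be a positive integer, let $a^*_d$ be the number of loop-less maximum independent sets (LMISs) of $B(d,3)$, and let $a_d$ be the number of maximum independent sets (MISs) of $B(d,3)$. Then $a^*_d=a_d$.
   Context: For a positive integer $d$ let $[d]=\{0,\dots,d-1\}$. The de Bruijn graph $B(d,3)$ is the directed graph whose nodes are the words $xyz$ with $x,y,z\in[d]$, with an edge from $x_1x_2x_3$ to $y_1y_2y_3$ if and only if $x_2x_3=y_1y_2$; in particular each node $xxx$ has an edge to itself. An independent set is a set of nodes such that no edge joins two (not necessarily distinct) of its elements. An LMIS of $B(d,3)$ is an independent set of maximum cardinality of $B(d,3)$ (so it contains no node $xxx$). An MIS of $B(d,3)$ is an independent set of maximum cardinality of the graph obtained from $B(d,3)$ by deleting the self-edges $xxx\to xxx$, $x\in[d]$. *)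

theory Defs
  imports "Graph_Theory.Pair_Digraph"
begin

text \<open>The de Bruijn graph B(d,3); the word xyz is the triple (x, y, z).\<close>

definition de_bruijn3 :: "nat \<Rightarrow> (nat \<times> nat \<times> nat) pair_pre_digraph" where
  "de_bruijn3 d =
    \<lparr> pverts = {..<d} \<times> {..<d} \<times> {..<d},
      parcs = {((x1, x2, x3), (y1, y2, y3)) | x1 x2 x3 y1 y2 y3.
        {x1, x2, x3, y1, y2, y3} \<subseteq> {..<d} \<and> x2 = y1 \<and> x3 = y2} \<rparr>"

definition de_bruijn3_no_loops :: "nat \<Rightarrow> (nat \<times> nat \<times> nat) pair_pre_digraph" where
  "de_bruijn3_no_loops d =
    \<lparr> pverts = pverts (de_bruijn3 d),
      parcs = parcs (de_bruijn3 d) - {((x, x, x), (x, x, x)) | x. x < d} \<rparr>"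

text \<open>The two elements u and v may coincide, so an independent set contains no
  node that carries a self-edge.\<close>

definition independent_set :: "'a pair_pre_digraph \<Rightarrow> 'a set \<Rightarrow> bool" where
  "independent_set G S \<longleftrightarrow>
    S \<subseteq> pverts G \<and> (\<forall>u\<in>S. \<forall>v\<in>S. (u, v) \<notin> parcs G)"

text \<open>Intended for finite graphs only, since infinite sets have cardinality 0 here.\<close>

definition maximum_independent_set :: "'a pair_pre_digraph \<Rightarrow> 'a set \<Rightarrow> bool" where
  "maximum_independent_set G S \<longleftrightarrow>
    independent_set G S \<and> (\<forall>T. independent_set G T \<longrightarrow> card T \<le> card S)"

definition is_LMIS :: "nat \<Rightarrow> (nat \<times> nat \<times> nat) set \<Rightarrow> bool" where
  "is_LMIS d S \<longleftrightarrow> maximum_independent_set (de_bruijn3 d) S"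

definition is_MIS :: "nat \<Rightarrow> (nat \<times> nat \<times> nat) set \<Rightarrow> bool" where
  "is_MIS d S \<longleftrightarrow> maximum_independent_set (de_bruijn3_no_loops d) S"

lemma pair_fin_digraph_de_bruijn3: "pair_fin_digraph (de_bruijn3 d)"
proof unfold_locales
  show "finite (pverts (de_bruijn3 d))"
    by (simp add: de_bruijn3_def)
  have "parcs (de_bruijn3 d) \<subseteq> pverts (de_bruijn3 d) \<times> pverts (de_bruijn3 d)"
    by (auto simp: de_bruijn3_def)
  then show "finite (parcs (de_bruijn3 d))"
    by (rule finite_subset) (simp add: de_bruijn3_def)
qed (auto simp: de_bruijn3_def)

end

theory Submission
  imports Defs
begin

text \<open>The nonconstant words fall into rotation classes \<open>{xyz, yzx, zxy}\<close>, each of which is a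
  directed triangle, so an independent set has at most one word in each class. With self-edges
  taken into account this is the only obstruction to size: the words \<open>xyz\<close> with \<open>x < y \<ge> z\<close> meet every
  class, so an LMIS is an independent set of nonconstant words that meets every class.

  If self-edges are ignored and \<open>xxx\<close> belongs to an independent set, then the class of \<open>xxy\<close> can
  only be met by \<open>xyx\<close>. Since \<open>xyx\<close> and \<open>yxy\<close> are adjacent, \<open>k\<close> constant words force at least
  \<open>k (k - 1) / 2\<close> missed classes. The net gain \<open>k - k (k - 1) / 2\<close> is at most 1, with equality
  exactly for \<open>k = 1\<close> and \<open>k = 2\<close> (\<open>loop_indep_bound\<close>). So an MIS has one constant word more
  than missed classes, and contains one or two constant words. Both kinds are matched with LMISs.

  One constant word \<open>xxx\<close>: deleting it gives an LMIS that contains \<open>xyx\<close> for all \<open>y \<noteq> x\<close>; such a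
  letter \<open>x\<close> is called dominating, there is at most one, and \<open>xxx\<close> can be added back
  (\<open>one_loop_bij\<close>).

  Two constant words \<open>xxx\<close> and \<open>yyy\<close>: besides these the MIS contains \<open>xyx\<close> or \<open>yxy\<close>, and it
  contains \<open>xzx\<close> and \<open>yzy\<close> for every other letter \<open>z\<close>, which isolates the words over \<open>{x, y}\<close> from
  all other words of the set. The words over \<open>{x, y}\<close> can therefore be exchanged freely:
  \<open>{xxx, yyy, xyx}\<close> and \<open>{xxx, yyy, yxy}\<close> for \<open>{xxy, yyx}\<close> and \<open>{xyy, yxx}\<close>. The results are LMISs
  without a dominating letter (\<open>plain_bij\<close>, \<open>loop_bij\<close>).

  Every LMIS \<open>S\<close> without a dominating letter arises in this way (\<open>LMIS_top\<close>). Indeed \<open>S\<close> is a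
  directed cut: if \<open>P a b\<close> says that some word of \<open>S\<close> starts with \<open>ab\<close>, then \<open>S\<close> consists of the words
  \<open>abc\<close> with \<open>P a b\<close> and \<open>\<not> P b c\<close>, and \<open>P\<close> is not constant on the three pairs \<open>xy, yz, zx\<close> of any
  nonconstant word. This makes \<open>xyx \<in> S\<close> a strict order on the letters in which incomparability
  ties letters together in disjoint pairs, and a maximal letter is either dominating or one of a
  tied pair that lies above all other letters.\<close>

section \<open>Independent sets of words\<close>

definition words :: "nat \<Rightarrow> (nat \<times> nat \<times> nat) set" where
  "words d = {..<d} \<times> {..<d} \<times> {..<d}"

definition nonconst :: "nat \<Rightarrow> (nat \<times> nat \<times> nat) set" where
  "nonconst d = words d - {(x, x, x) |x. True}"

definition loop_free_indep :: "nat \<Rightarrow> (nat \<times> nat \<times> nat) set \<Rightarrow> bool" where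
  "loop_free_indep d S \<longleftrightarrow> S \<subseteq> words d \<and> (\<forall>a b c e. (a, b, c) \<in> S \<longrightarrow> (b, c, e) \<notin> S)"

text \<open>A set that is independent once self-edges are ignored: the only overlaps between its members
  are those of a constant word with itself.\<close>

definition loop_indep :: "nat \<Rightarrow> (nat \<times> nat \<times> nat) set \<Rightarrow> bool" where
  "loop_indep d S \<longleftrightarrow> S \<subseteq> words d \<and>
    (\<forall>a b c e. (a, b, c) \<in> S \<longrightarrow> (b, c, e) \<in> S \<longrightarrow> a = b \<and> b = c \<and> c = e)"

lemma independent_set_de_bruijn3:
  "independent_set (de_bruijn3 d) S \<longleftrightarrow> loop_free_indep d S"
proof
  assume *: "independent_set (de_bruijn3 d) S"
  then have sub: "S \<subseteq> words d"
    by (auto simp: independent_set_def de_bruijn3_def words_def)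
  show "loop_free_indep d S"
    unfolding loop_free_indep_def
  proof (intro conjI sub allI impI notI)
    fix a b c e assume in_S: "(a, b, c) \<in> S" "(b, c, e) \<in> S"
    then have "((a, b, c), (b, c, e)) \<notin> parcs (de_bruijn3 d)"
      using * by (auto simp: independent_set_def)
    moreover have "{a, b, c, e} \<subseteq> {..<d}"
      using in_S sub by (auto simp: words_def)
    ultimately show False by (auto simp: de_bruijn3_def)
  qed
next
  assume "loop_free_indep d S"
  then show "independent_set (de_bruijn3 d) S"
    by (auto simp: independent_set_def loop_free_indep_def de_bruijn3_def words_def)
qed

lemma independent_set_de_bruijn3_no_loops:
  "independent_set (de_bruijn3_no_loops d) S \<longleftrightarrow> loop_indep d S"
proof
  assume *: "independent_set (de_bruijn3_no_loops d) S"
  then have sub: "S \<subseteq> words d"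
    by (auto simp: independent_set_def de_bruijn3_no_loops_def de_bruijn3_def words_def)
  show "loop_indep d S"
    unfolding loop_indep_def
  proof (intro conjI sub allI impI)
    fix a b c e assume in_S: "(a, b, c) \<in> S" "(b, c, e) \<in> S"
    then have "((a, b, c), (b, c, e)) \<notin> parcs (de_bruijn3_no_loops d)"
      using * by (auto simp: independent_set_def)
    moreover have "{a, b, c, e} \<subseteq> {..<d}"
      using in_S sub by (auto simp: words_def)
    ultimately have "a = b \<and> b = c \<and> c = e"
      by (auto simp: de_bruijn3_no_loops_def de_bruijn3_def)
    then show "a = b" "b = c" "c = e" by auto
  qed
next
  assume "loop_indep d S"
  then show "independent_set (de_bruijn3_no_loops d) S"
    by (auto simp: independent_set_def loop_indep_def de_bruijn3_no_loops_def de_bruijn3_def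
        words_def) blast+
qed

lemma finite_words [simp]: "finite (words d)"
  by (simp add: words_def)

lemma finite_nonconst [simp]: "finite (nonconst d)"
  by (simp add: nonconst_def)

lemma loop_free_indep_words: "loop_free_indep d S \<Longrightarrow> S \<subseteq> words d"
  by (simp only: loop_free_indep_def)

lemma loop_indep_words: "loop_indep d S \<Longrightarrow> S \<subseteq> words d"
  by (simp only: loop_indep_def)

lemma loop_free_indepD:
  assumes "loop_free_indep d S" "(a, b, c) \<in> S"
  shows "(b, c, e) \<notin> S"
  using conjunct2[OF iffD1[OF loop_free_indep_def assms(1)], rule_format, OF assms(2)] .

lemma loop_indepD:
  assumes "loop_indep d S" "(a, b, c) \<in> S" "(b, c, e) \<in> S"
  shows "a = b \<and> b = c \<and> c = e"
  using conjunct2[OF iffD1[OF loop_indep_def assms(1)], rule_format, OF assms(2,3)] .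

lemma loop_free_indep_subset_nonconst: "loop_free_indep d S \<Longrightarrow> S \<subseteq> nonconst d"
  using loop_free_indep_words by (auto simp: nonconst_def dest: loop_free_indepD)

lemma loop_free_indep_finite: "loop_free_indep d S \<Longrightarrow> finite S"
  by (meson loop_free_indep_words finite_subset finite_words)

lemma loop_indep_finite: "loop_indep d S \<Longrightarrow> finite S"
  by (meson loop_indep_words finite_subset finite_words)

lemma loop_indep_remove_loops:
  assumes "loop_indep d S"
  shows "loop_free_indep d (S \<inter> nonconst d)"
  unfolding loop_free_indep_def
proof (intro conjI allI impI notI)
  show "S \<inter> nonconst d \<subseteq> words d" by (auto simp: nonconst_def)
  fix a b c e assume "(a, b, c) \<in> S \<inter> nonconst d" "(b, c, e) \<in> S \<inter> nonconst d"
  then show False using loop_indepD[OF assms, of a b c e] by (auto simp: nonconst_def)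
qed

section \<open>Rotation classes\<close>

fun rot :: "'a \<times> 'a \<times> 'a \<Rightarrow> 'a \<times> 'a \<times> 'a" where
  "rot (x, y, z) = (y, z, x)"

definition rotations :: "('a \<times> 'a \<times> 'a) set \<Rightarrow> ('a \<times> 'a \<times> 'a) set" where
  "rotations S = S \<union> rot ` S \<union> rot ` rot ` S"

lemma inj_rot: "inj rot"
  by (auto simp: inj_def)

lemma mem_rotations:
  "(x, y, z) \<in> rotations S \<longleftrightarrow> (x, y, z) \<in> S \<or> (y, z, x) \<in> S \<or> (z, x, y) \<in> S"
  by (force simp: rotations_def)

text \<open>The hypothesis excludes \<open>rot (rot u) \<in> S\<close> as well, because \<open>rot\<close> has order three; so the three
  rotated copies of \<open>S\<close> are disjoint.\<close>

lemma card_rotations: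
  assumes fin: "finite S" and disj: "\<And>u. u \<in> S \<Longrightarrow> rot u \<notin> S"
  shows "card (rotations S) = 3 * card S"
proof -
  have cycle: "rot (rot (rot u)) = u" for u :: "'a \<times> 'a \<times> 'a"
    by (cases u) simp
  have d1: "S \<inter> rot ` S = {}" using disj by blast
  have d2: "rot u \<noteq> rot (rot v)" if "u \<in> S" "v \<in> S" for u v
    using disj[OF that(2)] that injD[OF inj_rot, of u "rot v"] by metis
  have d3: "u \<noteq> rot (rot v)" if "u \<in> S" "v \<in> S" for u v
    using disj[OF that(1)] cycle[of v] that by auto
  have d: "(S \<union> rot ` S) \<inter> rot ` rot ` S = {}" using d2 d3 by blast
  have "card (rotations S) = card S + card (rot ` S) + card (rot ` rot ` S)"
    unfolding rotations_def using fin d1 d by (simp add: card_Un_disjoint)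
  also have "card (rot ` S) = card S"
    by (meson card_image inj_rot inj_on_subset top_greatest)
  also have "card (rot ` rot ` S) = card (rot ` S)"
    by (meson card_image inj_rot inj_on_subset top_greatest)
  also have "card (rot ` S) = card S"
    by (meson card_image inj_rot inj_on_subset top_greatest)
  finally show ?thesis by simp
qed

text \<open>The union of the rotation classes that \<open>S\<close> does not meet.\<close>

definition missed :: "nat \<Rightarrow> (nat \<times> nat \<times> nat) set \<Rightarrow> (nat \<times> nat \<times> nat) set" where
  "missed d S = nonconst d - rotations S"

lemma rotations_subset_nonconst: "S \<subseteq> nonconst d \<Longrightarrow> rotations S \<subseteq> nonconst d"
  by (force simp: rotations_def nonconst_def words_def)

lemma finite_missed [simp]: "finite (missed d S)"
  by (simp add: missed_def)

text \<open>Every class has three words, of which an independent set contains at most one.\<close>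

lemma card_missed:
  assumes "loop_free_indep d S"
  shows "card (missed d S) + 3 * card S = card (nonconst d)"
proof -
  have "rotations S \<subseteq> nonconst d"
    using assms by (intro rotations_subset_nonconst loop_free_indep_subset_nonconst)
  moreover have "card (rotations S) = 3 * card S"
    using assms loop_free_indep_finite
    by (intro card_rotations) (auto simp: loop_free_indepD)
  ultimately show ?thesis
    unfolding missed_def
    by (metis card_Diff_subset card_mono finite_nonconst finite_subset le_add_diff_inverse2)
qed

lemma unmissed:
  assumes "missed d S = {}" "x < d" "y < d" "z < d" "\<not> (x = y \<and> y = z)"
  shows "(x, y, z) \<in> S \<or> (y, z, x) \<in> S \<or> (z, x, y) \<in> S"
proof -
  have "(x, y, z) \<in> nonconst d" using assms by (auto simp: nonconst_def words_def)
  then show ?thesis using assms(1) mem_rotations[of x y z S] by (auto simp: missed_def)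
qed

section \<open>The two independence numbers\<close>

definition peaks :: "nat \<Rightarrow> (nat \<times> nat \<times> nat) set" where
  "peaks d = {(x, y, z) \<in> words d. x < y \<and> z \<le> y}"

lemma peaks_indep: "loop_free_indep d (peaks d)"
  by (auto simp: loop_free_indep_def peaks_def)

text \<open>A nonconstant cyclic sequence ascends somewhere but not everywhere, so an ascent is followed
  by a non-ascent.\<close>

lemma peaks_complete: "missed d (peaks d) = {}"
proof -
  have "(x, y, z) \<in> rotations (peaks d)" if "(x, y, z) \<in> nonconst d" for x y z
  proof -
    have r: "x < d" "y < d" "z < d" and "\<not> (x = y \<and> y = z)"
      using that by (auto simp: nonconst_def words_def)
    then have "x < y \<and> z \<le> y \<or> y < z \<and> x \<le> z \<or> z < x \<and> y \<le> x" by linarith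
    then show ?thesis using r by (auto simp: mem_rotations peaks_def words_def)
  qed
  then show ?thesis by (auto simp: missed_def)
qed

lemma is_LMIS_iff:
  "is_LMIS d S \<longleftrightarrow> loop_free_indep d S \<and> missed d S = {}"
proof -
  have le: "3 * card T \<le> card (nonconst d)" if "loop_free_indep d T" for T
    using card_missed[OF that] by simp
  have full: "3 * card T = card (nonconst d) \<longleftrightarrow> missed d T = {}"
    if "loop_free_indep d T" for T
    using card_missed[OF that] by auto
  have "3 * card (peaks d) = card (nonconst d)"
    using full[OF peaks_indep] peaks_complete by simp
  then show ?thesis
    unfolding is_LMIS_def maximum_independent_set_def independent_set_de_bruijn3
    using le full peaks_indep by (smt (verit) le_antisym mult_le_cancel1 zero_less_numeral)
qed

definition loops :: "(nat \<times> nat \<times> nat) set \<Rightarrow> nat set" where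
  "loops S = {x. (x, x, x) \<in> S}"

lemma finite_loops:
  assumes "loop_indep d S"
  shows "finite (loops S)"
proof (rule finite_subset)
  show "loops S \<subseteq> {..<d}"
    using loop_indep_words[OF assms] by (auto simp: loops_def words_def)
qed simp

lemma card_loop_indep:
  assumes "loop_indep d S"
  shows "card S = card (loops S) + card (S \<inter> nonconst d)"
proof -
  have S: "(\<lambda>x. (x, x, x)) ` loops S \<union> (S \<inter> nonconst d) = S"
    using loop_indep_words[OF assms] by (auto simp: loops_def nonconst_def)
  have "card ((\<lambda>x. (x, x, x)) ` loops S) = card (loops S)"
    by (rule card_image) (simp add: inj_on_def)
  moreover have "(\<lambda>x. (x, x, x)) ` loops S \<inter> (S \<inter> nonconst d) = {}"
    by (auto simp: nonconst_def)
  ultimately have "card ((\<lambda>x. (x, x, x)) ` loops S \<union> (S \<inter> nonconst d)) =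
      card (loops S) + card (S \<inter> nonconst d)"
    using finite_loops[OF assms] by (simp add: card_Un_disjoint)
  then show ?thesis unfolding S .
qed

lemma loop_excludes:
  assumes "loop_indep d S" "(x, x, x) \<in> S" "x \<noteq> y"
  shows "(x, x, y) \<notin> S" "(y, x, x) \<notin> S"
  using loop_indepD[OF assms(1,2)] loop_indepD[OF assms(1) _ assms(2)] assms(3) by metis+

text \<open>If \<open>xxx \<in> S\<close>, then \<open>xyx\<close> is the only word of its class that is not adjacent to \<open>xxx\<close>.\<close>

lemma loop_forces:
  assumes "loop_indep d S" "(x, x, x) \<in> S" "x \<noteq> y" "y < d" "(x, y, x) \<notin> S"
  shows "{(x, x, y), (x, y, x), (y, x, x)} \<subseteq> missed d (S \<inter> nonconst d)"
proof -
  have "x < d" using assms(2) loop_indep_words[OF assms(1)] by (auto simp: words_def)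
  then show ?thesis
    using loop_excludes[OF assms(1-3)] assms by (auto simp: missed_def mem_rotations nonconst_def words_def)
qed

text \<open>The bound says that \<open>k\<close> constant words cost at least \<open>k (k - 1) / 2\<close> classes of three words,
  stated without division or truncated subtraction. For each pair of constant words \<open>xxx, yyy\<close>
  one of \<open>xyx, yxy\<close> is absent, since they are adjacent, and its class is then missed.\<close>

lemma card_missed_loops:
  assumes S: "loop_indep d S"
  shows "3 * (card (loops S) * card (loops S)) \<le>
    2 * card (missed d (S \<inter> nonconst d)) + 3 * card (loops S)"
proof -
  define L where "L = loops S"
  define Q where "Q = {(x, y) \<in> L \<times> L. x \<noteq> y \<and> (x, y, x) \<notin> S}"
  have finL: "finite L" using finite_loops[OF S] by (simp add: L_def)
  then have finQ: "finite Q" by (auto simp: Q_def intro: finite_subset[of _ "L \<times> L"])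
  \<comment> \<open>\<open>Q\<close> contains at least one orientation of each pair of distinct elements of \<open>L\<close>.\<close>
  have "L \<times> L \<subseteq> Id_on L \<union> (Q \<union> prod.swap ` Q)"
  proof
    fix p assume "p \<in> L \<times> L"
    then obtain x y where p: "p = (x, y)" "x \<in> L" "y \<in> L" by auto
    have "x = y \<or> (x, y, x) \<notin> S \<or> (y, x, y) \<notin> S"
      using loop_indepD[OF S, of x y x y] by auto
    then show "p \<in> Id_on L \<union> (Q \<union> prod.swap ` Q)"
      using p by (force simp: Q_def)
  qed
  then have "card (L \<times> L) \<le> card (Id_on L \<union> (Q \<union> prod.swap ` Q))"
    using finL finQ by (intro card_mono) (auto simp: Id_on_def)
  also have "\<dots> \<le> card (Id_on L) + (card Q + card (prod.swap ` Q))"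
    by (meson card_Un_le add_left_mono order_trans)
  also have "card (Id_on L) = card L"
    using card_image[of "\<lambda>x. (x, x)" L] by (simp add: Id_on_def inj_on_def UNION_singleton_eq_range)
  also have "card (prod.swap ` Q) = card Q"
    by (simp add: card_image)
  finally have 1: "card L * card L \<le> card L + 2 * card Q"
    by (simp add: card_cartesian_product)
  define R where "R = (\<lambda>(x, y). (x, x, y)) ` Q"
  have "card R = card Q" unfolding R_def by (rule card_image) (auto simp: inj_on_def)
  moreover have "card (rotations R) = 3 * card R"
    using finQ by (intro card_rotations) (auto simp: R_def Q_def)
  moreover have "rotations R \<subseteq> missed d (S \<inter> nonconst d)"
  proof
    fix u assume "u \<in> rotations R"
    then obtain x y where xy: "(x, y) \<in> Q" "u \<in> {(x, x, y), (x, y, x), (y, x, x)}"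
      by (auto simp: R_def rotations_def)
    moreover have "y < d"
      using xy(1) loop_indep_words[OF S] by (auto simp: Q_def L_def loops_def words_def)
    ultimately show "u \<in> missed d (S \<inter> nonconst d)"
      using loop_forces[OF S, of x y] by (auto simp: Q_def L_def loops_def)
  qed
  ultimately have "3 * card Q \<le> card (missed d (S \<inter> nonconst d))"
    by (metis card_mono finite_missed)
  with 1 show ?thesis by (simp add: L_def)
qed

text \<open>The gap in the first inequality is at least \<open>3 (k - 1) (k - 2) / 2\<close>, where \<open>k\<close> is
  the number of constant words in \<open>S\<close>; this product is nonnegative for every integer \<open>k\<close>.\<close>

lemma loop_indep_bound:
  assumes S: "loop_indep d S"
  shows "3 * card S \<le> card (nonconst d) + 3"
    and "3 * card S = card (nonconst d) + 3 \<Longrightarrow> card (loops S) = 1 \<or> card (loops S) = 2"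
proof -
  define k where "k = int (card (loops S))"
  define m where "m = int (card (missed d (S \<inter> nonconst d)))"
  define s where "s = int (card (S \<inter> nonconst d))"
  define n where "n = int (card (nonconst d))"
  have 1: "3 * (k * k) \<le> 2 * m + 3 * k"
    using of_nat_mono[OF card_missed_loops[OF S], where ?'a = int] unfolding k_def m_def by simp
  have 2: "m + 3 * s = n"
    using card_missed[OF loop_indep_remove_loops[OF S]] unfolding m_def n_def s_def
    by linarith
  have 3: "int (card S) = k + s"
    using card_loop_indep[OF S] by (simp add: k_def s_def)
  have key: "(k - 1) * (k - 2) \<ge> 0"
  proof (cases "k \<ge> 2")
    case True then show ?thesis by simp
  next
    case False then show ?thesis by (intro mult_nonpos_nonpos) auto
  qed
  have "2 * (n + 3) - 2 * (3 * int (card S)) \<ge> 3 * ((k - 1) * (k - 2))"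
    using 1 2 3 by (simp add: algebra_simps)
  moreover define q where "q = (k - 1) * (k - 2)"
  ultimately have q: "2 * (n + 3) - 2 * (3 * int (card S)) \<ge> 3 * q" "q \<ge> 0"
    using key by simp_all
  have le: "3 * int (card S) \<le> n + 3" using q by presburger
  have eq: "q = 0" if "3 * int (card S) = n + 3" using q that by presburger
  show "3 * card S \<le> card (nonconst d) + 3" using le unfolding n_def by linarith
  assume "3 * card S = card (nonconst d) + 3"
  then have "(k - 1) * (k - 2) = 0" using eq unfolding n_def q_def by linarith
  then show "card (loops S) = 1 \<or> card (loops S) = 2" by (auto simp: k_def)
qed

definition dominating :: "nat \<Rightarrow> (nat \<times> nat \<times> nat) set \<Rightarrow> nat \<Rightarrow> bool" where
  "dominating d S x \<longleftrightarrow> x < d \<and> (\<forall>y<d. y \<noteq> x \<longrightarrow> (x, y, x) \<in> S)"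

lemma dominating_unique:
  assumes "loop_free_indep d S" "dominating d S x" "dominating d S y"
  shows "x = y"
proof (rule ccontr)
  assume "x \<noteq> y"
  then have "(x, y, x) \<in> S" "(y, x, y) \<in> S" using assms(2,3) by (auto simp: dominating_def)
  then show False using loop_free_indepD[OF assms(1)] by blast
qed

text \<open>A neighbour of \<open>xxx\<close> has the form \<open>xxy\<close> or \<open>yxx\<close>, and both are adjacent to \<open>xyx\<close>.\<close>

lemma add_dominating_loop:
  assumes S: "loop_free_indep d S" and x: "dominating d S x"
  shows "loop_indep d (insert (x, x, x) S)"
proof -
  have xd: "x < d" and sub: "S \<subseteq> words d"
    using loop_free_indep_words[OF S] x by (auto simp: dominating_def)
  have iso: "(x, x, y) \<notin> S \<and> (y, x, x) \<notin> S" for y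
  proof (cases "y = x \<or> y \<ge> d")
    case True
    then show ?thesis using loop_free_indepD[OF S] sub by (auto simp: words_def)
  next
    case False
    then have "(x, y, x) \<in> S" using x by (auto simp: dominating_def)
    then show ?thesis using loop_free_indepD[OF S] by blast
  qed
  show ?thesis
    unfolding loop_indep_def
  proof (intro conjI)
    show "insert (x, x, x) S \<subseteq> words d" using sub xd by (simp add: words_def)
    show "\<forall>a b c e. (a, b, c) \<in> insert (x, x, x) S \<longrightarrow> (b, c, e) \<in> insert (x, x, x) S \<longrightarrow>
        a = b \<and> b = c \<and> c = e"
      using iso loop_free_indepD[OF S] by (metis insert_iff prod.inject)
  qed
qed

text \<open>The bound is attained by the words \<open>xyz\<close> with \<open>x < y \<ge> z\<close> together with \<open>000\<close>; here \<open>d > 0\<close>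
  provides the letter \<open>0\<close>, which is dominating.\<close>

lemma is_MIS_iff:
  assumes "d > 0"
  shows "is_MIS d S \<longleftrightarrow> loop_indep d S \<and> 3 * card S = card (nonconst d) + 3"
proof -
  let ?W = "insert (0, 0, 0) (peaks d)"
  have "dominating d (peaks d) 0"
    using assms by (auto simp: dominating_def peaks_def words_def)
  then have W: "loop_indep d ?W" by (rule add_dominating_loop[OF peaks_indep])
  have "card ?W = card (peaks d) + 1"
    using loop_free_indep_finite[OF peaks_indep] by (simp add: peaks_def)
  then have "3 * card ?W = card (nonconst d) + 3"
    using card_missed[OF peaks_indep] peaks_complete by simp
  then show ?thesis
    unfolding is_MIS_def maximum_independent_set_def independent_set_de_bruijn3_no_loops
    using loop_indep_bound(1) W
    by (smt (verit) le_antisym mult_le_cancel1 zero_less_numeral)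
qed

section \<open>Maximum independent sets with one loop\<close>

lemma one_loop_bij:
  assumes d: "d > 0"
  shows "bij_betw (\<lambda>S. S \<inter> nonconst d) {S. is_MIS d S \<and> card (loops S) = 1}
    {S. is_LMIS d S \<and> (\<exists>x. dominating d S x)}" (is "bij_betw ?f ?M ?L")
proof (rule bij_betw_byWitness[where f' = "\<lambda>S. S \<union> {(x, x, x) |x. dominating d S x}"])
  have main: "is_LMIS d (?f S) \<and> (\<exists>x. dominating d (?f S) x \<and> S = insert (x, x, x) (?f S))"
    if "S \<in> ?M" for S
  proof -
    have S: "loop_indep d S" and c: "3 * card S = card (nonconst d) + 3"
      and l: "card (loops S) = 1" using that is_MIS_iff[OF d] by auto
    obtain x where x: "loops S = {x}" using l by (auto simp: card_1_singleton_iff)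
    then have xS: "(x, x, x) \<in> S" by (auto simp: loops_def)
    have S0: "loop_free_indep d (?f S)" by (rule loop_indep_remove_loops[OF S])
    have m: "missed d (?f S) = {}"
      using card_missed[OF S0] card_loop_indep[OF S] c l by simp
    have "dominating d (?f S) x"
      unfolding dominating_def
    proof (intro conjI allI impI)
      show xd: "x < d" using xS loop_indep_words[OF S] by (auto simp: words_def)
      fix y assume y: "y < d" "y \<noteq> x"
      then have "(x, y, x) \<in> S" using loop_forces[OF S xS, of y] m by auto
      then show "(x, y, x) \<in> ?f S" using xd y by (auto simp: nonconst_def words_def)
    qed
    moreover have "S = insert (x, x, x) (?f S)"
      using x loop_indep_words[OF S] by (auto simp: loops_def nonconst_def)
    ultimately show ?thesis using S0 m is_LMIS_iff by blast
  qed
  have dom_loops: "{(y, y, y) |y. dominating d S y} = {(x, x, x)}"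
    if "is_LMIS d S" "dominating d S x" for S x
    using that dominating_unique is_LMIS_iff by blast
  show "\<forall>S\<in>?M. ?f S \<union> {(x, x, x) |x. dominating d (?f S) x} = S"
  proof
    fix S assume "S \<in> ?M"
    then obtain x where x: "is_LMIS d (?f S)" "dominating d (?f S) x" "S = insert (x, x, x) (?f S)"
      using main by blast
    show "?f S \<union> {(x, x, x) |x. dominating d (?f S) x} = S"
      unfolding dom_loops[OF x(1,2)] using x(3) by blast
  qed
  show "?f ` ?M \<subseteq> ?L" using main by blast
  have restore: "insert (x, x, x) S \<in> ?M \<and> ?f (insert (x, x, x) S) = S"
    if "is_LMIS d S" and x: "dominating d S x" for S x
  proof -
    have S: "loop_free_indep d S" "missed d S = {}" using that is_LMIS_iff by auto
    have nc: "S \<subseteq> nonconst d" by (rule loop_free_indep_subset_nonconst[OF S(1)])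
    then have l: "loops (insert (x, x, x) S) = {x}" by (auto simp: loops_def nonconst_def)
    have "(x, x, x) \<notin> S" using nc by (auto simp: nonconst_def)
    then have "3 * card (insert (x, x, x) S) = card (nonconst d) + 3"
      using card_missed[OF S(1)] S loop_free_indep_finite by simp
    then show ?thesis
      using add_dominating_loop[OF S(1) x] is_MIS_iff[OF d] l nc by (auto simp: nonconst_def)
  qed
  have ext: "S \<union> {(x, x, x) |x. dominating d S x} \<in> ?M \<and>
      ?f (S \<union> {(x, x, x) |x. dominating d S x}) = S" if S: "S \<in> ?L" for S
  proof -
    obtain x where x: "is_LMIS d S" "dominating d S x" using S by blast
    have "S \<union> {(x, x, x) |x. dominating d S x} = insert (x, x, x) S"
      unfolding dom_loops[OF x] by blast
    then show ?thesis using restore[OF x] by simp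
  qed
  show "\<forall>S\<in>?L. ?f (S \<union> {(x, x, x) |x. dominating d S x}) = S"
    using ext by blast
  show "(\<lambda>S. S \<union> {(x, x, x) |x. dominating d S x}) ` ?L \<subseteq> ?M"
    using ext by blast
qed

section \<open>Exchanging a top pair\<close>

definition cube :: "'a \<Rightarrow> 'a \<Rightarrow> ('a \<times> 'a \<times> 'a) set" where
  "cube x y = {x, y} \<times> {x, y} \<times> {x, y}"

text \<open>The part outside \<open>cube x y\<close> of the sets in which words over \<open>{x, y}\<close> are exchanged. The last
  equation says that a core misses exactly the two classes of \<open>xxy\<close> and \<open>yyx\<close>.\<close>

definition core :: "nat \<Rightarrow> nat \<Rightarrow> nat \<Rightarrow> (nat \<times> nat \<times> nat) set \<Rightarrow> bool" where
  "core d x y T \<longleftrightarrow> x < d \<and> y < d \<and> x \<noteq> y \<and> loop_free_indep d T \<and> T \<inter> cube x y = {} \<and>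
    (\<forall>z<d. z \<noteq> x \<longrightarrow> z \<noteq> y \<longrightarrow> (x, z, x) \<in> T \<and> (y, z, y) \<in> T) \<and>
    3 * card T + 6 = card (nonconst d)"

text \<open>The two ways to complete a core to an LMIS, and the two ways to complete it to an MIS. The
  Boolean argument says which one is taken.\<close>

fun plain_part :: "bool \<Rightarrow> 'a \<Rightarrow> 'a \<Rightarrow> ('a \<times> 'a \<times> 'a) set" where
  "plain_part True x y = {(x, x, y), (y, y, x)}"
| "plain_part False x y = {(x, y, y), (y, x, x)}"

fun loop_part :: "bool \<Rightarrow> 'a \<Rightarrow> 'a \<Rightarrow> ('a \<times> 'a \<times> 'a) set" where
  "loop_part True x y = {(x, x, x), (y, y, y), (x, y, x)}"
| "loop_part False x y = {(x, x, x), (y, y, y), (y, x, y)}"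

text \<open>If \<open>b\<close> and \<open>c\<close> are \<open>x\<close> or \<open>y\<close> and \<open>z\<close> is another letter, then \<open>bzb\<close> is adjacent to \<open>zbc\<close> and
  \<open>czc\<close> is adjacent to \<open>bcz\<close>. Hence a core has no word adjacent to a word over \<open>{x, y}\<close>.\<close>

lemma core_isolated:
  assumes T: "core d x y T" and b: "b \<in> {x, y}" "c \<in> {x, y}"
  shows "(z, b, c) \<notin> T" "(b, c, z) \<notin> T"
proof -
  have I: "loop_free_indep d T" using T by (simp add: core_def)
  have "(z, b, c) \<notin> T \<and> (b, c, z) \<notin> T"
  proof (cases "z \<in> {x, y} \<or> z \<ge> d")
    case True
    then show ?thesis
    proof
      assume "z \<in> {x, y}"
      then have "(z, b, c) \<in> cube x y" "(b, c, z) \<in> cube x y" 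
        using b unfolding cube_def by blast+
      then show ?thesis using T by (auto simp: core_def)
    next
      assume "z \<ge> d"
      then show ?thesis using loop_free_indep_words[OF I] by (auto simp: words_def)
    qed
  next
    case False
    then have "(b, z, b) \<in> T" "(c, z, c) \<in> T" using T b by (auto simp: core_def)
    then show ?thesis using loop_free_indepD[OF I] by blast
  qed
  then show "(z, b, c) \<notin> T" "(b, c, z) \<notin> T" by auto
qed

lemma parts_subset_cube: "plain_part b x y \<subseteq> cube x y" "loop_part b x y \<subseteq> cube x y"
  unfolding atomize_conj by (cases b) (auto simp: cube_def)

lemma part_inject:
  assumes "x \<noteq> y"
  shows "plain_part b x y = plain_part b' x y \<Longrightarrow> b = b'"
    and "loop_part b x y = loop_part b' x y \<Longrightarrow> b = b'"
proof -
  have "(x, x, y) \<in> plain_part b x y \<longleftrightarrow> b" for b using assms by (cases b) auto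
  then show "plain_part b x y = plain_part b' x y \<Longrightarrow> b = b'" by metis
  have "(x, y, x) \<in> loop_part b x y \<longleftrightarrow> b" for b using assms by (cases b) auto
  then show "loop_part b x y = loop_part b' x y \<Longrightarrow> b = b'" by metis
qed

lemma core_union_inject:
  assumes "core d x y T" "core d x y T'" "X \<subseteq> cube x y" "X' \<subseteq> cube x y" "T \<union> X = T' \<union> X'"
  shows "T = T' \<and> X = X'"
proof -
  have "T \<inter> cube x y = {}" "T' \<inter> cube x y = {}" using assms(1,2) by (simp_all add: core_def)
  then have "T = (T \<union> X) - cube x y" "X = (T \<union> X) \<inter> cube x y"
    "T' = (T' \<union> X') - cube x y" "X' = (T' \<union> X') \<inter> cube x y"
    using assms(3,4) by (simp_all only: set_eq_iff subset_iff) blast+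
  then show ?thesis using assms(5) by metis
qed

text \<open>Since the core is isolated from the words over \<open>{x, y}\<close>, independence of a completed core only
  depends on the part that was added.\<close>

lemma core_overlap:
  assumes T: "core d x y T" and X: "X \<subseteq> cube x y"
    and in_TX: "(a, b, c) \<in> T \<union> X" "(b, c, e) \<in> T \<union> X"
  shows "(a, b, c) \<in> X" "(b, c, e) \<in> X"
proof -
  have "(b, c, e) \<notin> T" if "(a, b, c) \<in> T"
    using T that loop_free_indepD by (auto simp: core_def)
  moreover have "b \<in> {x, y} \<and> c \<in> {x, y}" if "(a, b, c) \<in> X \<or> (b, c, e) \<in> X"
    using that X by (auto simp: cube_def)
  ultimately show "(a, b, c) \<in> X" "(b, c, e) \<in> X"
    using in_TX core_isolated[OF T] by blast+
qed

lemma core_extend: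
  assumes T: "core d x y T"
  shows "loop_free_indep d (T \<union> plain_part b x y)" "loop_indep d (T \<union> loop_part b x y)"
proof -
  have I: "T \<subseteq> words d" and xy: "x < d" "y < d" "x \<noteq> y"
    using T loop_free_indep_words by (auto simp: core_def)
  have sub: "cube x y \<subseteq> words d" using xy by (auto simp: cube_def words_def)
  have P: "(v, w, t) \<notin> plain_part b x y" if "(u, v, w) \<in> plain_part b x y" for u v w t
    using xy that by (cases b) auto
  have L: "u = v \<and> v = w \<and> w = t"
    if "(u, v, w) \<in> loop_part b x y" "(v, w, t) \<in> loop_part b x y" for u v w t
    using xy that by (cases b) auto
  show "loop_free_indep d (T \<union> plain_part b x y)"
    unfolding loop_free_indep_def
  proof (intro conjI allI impI notI)
    show "T \<union> plain_part b x y \<subseteq> words d" using I sub parts_subset_cube[of b x y] by blast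
    fix u v w t assume "(u, v, w) \<in> T \<union> plain_part b x y" "(v, w, t) \<in> T \<union> plain_part b x y"
    from core_overlap[OF T parts_subset_cube(1) this] show False using P by blast
  qed
  show "loop_indep d (T \<union> loop_part b x y)"
    unfolding loop_indep_def
  proof (intro conjI[where P = "T \<union> loop_part b x y \<subseteq> words d"] allI impI)
    show "T \<union> loop_part b x y \<subseteq> words d" using I sub parts_subset_cube[of b x y] by blast
    fix u v w t assume "(u, v, w) \<in> T \<union> loop_part b x y" "(v, w, t) \<in> T \<union> loop_part b x y"
    from core_overlap[OF T parts_subset_cube(2) this] show "u = v \<and> v = w \<and> w = t" by (rule L)
  qed
qed

lemma card_core_extend:
  assumes T: "core d x y T"
  shows "card (T \<union> plain_part b x y) = card T + 2" "card (T \<union> loop_part b x y) = card T + 3"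
proof -
  have fin: "finite T" using T loop_free_indep_finite by (auto simp: core_def)
  have xy: "x \<noteq> y" and dj: "T \<inter> cube x y = {}" using T by (auto simp: core_def)
  have "card (plain_part b x y) = 2" "card (loop_part b x y) = 3"
    "finite (plain_part b x y)" "finite (loop_part b x y)"
    unfolding atomize_conj using xy by (cases b; simp)
  then show "card (T \<union> plain_part b x y) = card T + 2" "card (T \<union> loop_part b x y) = card T + 3"
    using fin dj parts_subset_cube[of b x y] card_Un_disjoint[of T "plain_part b x y"]
      card_Un_disjoint[of T "loop_part b x y"] by auto
qed

lemma core_LMIS:
  assumes T: "core d x y T"
  shows "is_LMIS d (T \<union> plain_part b x y)"
proof -
  have "card (missed d (T \<union> plain_part b x y)) = 0"
    using card_missed[OF core_extend(1)[OF T, of b]] card_core_extend(1)[OF T, of b] T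
    unfolding core_def by linarith
  then show ?thesis
    using core_extend(1)[OF T, of b] by (simp add: is_LMIS_iff)
qed

text \<open>Neither \<open>x\<close> nor \<open>y\<close> is dominating, as both \<open>xyx\<close> and \<open>yxy\<close> are absent; another letter \<open>v\<close>
  cannot have \<open>vxv\<close>, which is adjacent to \<open>xvx\<close>.\<close>

lemma core_not_dominating:
  assumes T: "core d x y T"
  shows "\<not> dominating d (T \<union> plain_part b x y) v"
proof
  assume v: "dominating d (T \<union> plain_part b x y) v"
  have xy: "x < d" "y < d" "x \<noteq> y" using T by (auto simp: core_def)
  show False
  proof (cases "v \<in> {x, y}")
    case True
    then have "(x, y, x) \<in> T \<union> plain_part b x y \<or> (y, x, y) \<in> T \<union> plain_part b x y"
      using v xy by (auto simp: dominating_def)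
    then show False using T xy by (cases b) (auto simp: core_def cube_def)
  next
    case False
    then have "(x, v, x) \<in> T \<union> plain_part b x y" "(v, x, v) \<in> T \<union> plain_part b x y"
      using v T xy by (auto simp: dominating_def core_def)
    then show False using loop_free_indepD[OF core_extend(1)[OF T]] by blast
  qed
qed

lemma core_MIS:
  assumes T: "core d x y T"
  shows "is_MIS d (T \<union> loop_part b x y)" "loops (T \<union> loop_part b x y) = {x, y}"
proof -
  have "d > 0" using T by (auto simp: core_def)
  then show "is_MIS d (T \<union> loop_part b x y)"
    using core_extend(2)[OF T, of b] card_core_extend(2)[OF T, of b] T
    by (auto simp: is_MIS_iff core_def)
  show "loops (T \<union> loop_part b x y) = {x, y}"
    using T loop_free_indepD[of d T]
    by (cases b) (auto simp: loops_def core_def)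
qed

text \<open>An MIS with two constant words misses only one class, of three words. That is the class of
  \<open>yxy\<close>, so all other words that \<open>xxx\<close> and \<open>yyy\<close> force are present.\<close>

lemma two_loops_core_aux:
  assumes d: "d > 0" and "is_MIS d S" and l: "loops S = {x, y}" "x \<noteq> y" and no: "(y, x, y) \<notin> S"
  shows "S \<inter> cube x y = loop_part True x y \<and> core d x y (S - cube x y)"
proof -
  let ?S = "S \<inter> nonconst d"
  have S: "loop_indep d S" and c: "3 * card S = card (nonconst d) + 3"
    using assms is_MIS_iff by auto
  have S0: "loop_free_indep d ?S" by (rule loop_indep_remove_loops[OF S])
  have xS: "(x, x, x) \<in> S" and yS: "(y, y, y) \<in> S" using l by (auto simp: loops_def)
  have xy: "x < d" "y < d" using xS yS loop_indep_words[OF S] by (auto simp: words_def)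
  have "card (missed d ?S) = 3"
    using card_missed[OF S0] card_loop_indep[OF S] c l by simp
  moreover have "{(y, y, x), (y, x, y), (x, y, y)} \<subseteq> missed d ?S"
    using loop_forces[OF S yS _ xy(1) no] l by auto
  moreover have "card {(y, y, x), (y, x, y), (x, y, y)} = 3" using l by simp
  ultimately have m: "missed d ?S = {(y, y, x), (y, x, y), (x, y, y)}"
    by (metis card_subset_eq finite_missed)
  have xyx: "(x, y, x) \<in> S" using loop_forces[OF S xS l(2) xy(2)] m l(2) by auto
  have Z: "(x, z, x) \<in> S" "(y, z, y) \<in> S" if "z < d" "z \<noteq> x" "z \<noteq> y" for z
    using loop_forces[OF S xS _ that(1)] loop_forces[OF S yS _ that(1)] m that by auto
  have cube: "S \<inter> cube x y = loop_part True x y"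
    using loop_excludes[OF S xS l(2)] loop_excludes[OF S yS l(2)[symmetric]] xS yS xyx no
    by (auto simp: cube_def)
  have "loop_free_indep d (S - cube x y)"
    unfolding loop_free_indep_def
  proof (intro conjI allI impI notI)
    show "S - cube x y \<subseteq> words d" using loop_indep_words[OF S] by blast
    fix a b c e assume *: "(a, b, c) \<in> S - cube x y" "(b, c, e) \<in> S - cube x y"
    then have "a = b \<and> b = c" using loop_indepD[OF S, of a b c e] by blast
    then have "a \<in> loops S" "(a, a, a) \<notin> cube x y" using * by (auto simp: loops_def)
    then show False using l(1) by (auto simp: cube_def)
  qed
  moreover have "card S = card (S - cube x y) + 3"
  proof -
    have "card (S \<inter> cube x y) = 3" unfolding cube using l(2) by simp
    then show ?thesis using card_Int_Diff[OF loop_indep_finite[OF S], of "cube x y"] by simp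
  qed
  ultimately show ?thesis
    using cube Z xy l(2) c by (auto simp: core_def cube_def)
qed

lemma core_commute: "core d x y T \<longleftrightarrow> core d y x T"
proof -
  have "cube x y = cube y x" by (auto simp: cube_def)
  then show ?thesis unfolding core_def by metis
qed

lemma two_loops_core:
  assumes d: "d > 0" and S: "is_MIS d S" and l: "loops S = {x, y}" "x \<noteq> y"
  obtains b where "S \<inter> cube x y = loop_part b x y" "core d x y (S - cube x y)"
proof (cases "(y, x, y) \<in> S")
  case False
  then show ?thesis using two_loops_core_aux[OF d S l] that by blast
next
  case True
  have I: "loop_indep d S" using S is_MIS_iff[OF d] by simp
  have "(x, y, x) \<notin> S" using loop_indepD[OF I True] l(2) by auto
  moreover have "loops S = {y, x}" using l by auto
  ultimately have *: "S \<inter> cube y x = loop_part True y x" "core d y x (S - cube y x)"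
    using two_loops_core_aux[OF d S, of y x] l by auto
  have "cube y x = cube x y" "loop_part True y x = loop_part False x y" by (auto simp: cube_def)
  then show ?thesis using * that core_commute by metis
qed

section \<open>The order on the letters\<close>

text \<open>A relation that is not constant on the three pairs \<open>xy, yz, zx\<close>, unless \<open>x = y = z\<close>, is nearly
  a linear order. The triangles \<open>xxy\<close> show that tied letters \<open>x, y\<close>, for which \<open>P x y\<close> and \<open>P y x\<close>
  agree, have \<open>P x x\<close> and \<open>P y y\<close> opposite to this value. It follows that each letter is tied to at
  most one other, that tied letters compare in the same way with all others, and that the strict
  relation \<open>above\<close> is transitive.\<close>

lemma top_letter_or_pair:
  fixes P :: "nat \<Rightarrow> nat \<Rightarrow> bool"
  assumes d: "d > 0"
    and pos: "\<And>x y z. x < d \<Longrightarrow> y < d \<Longrightarrow> z < d \<Longrightarrow> \<not> (x = y \<and> y = z) \<Longrightarrow>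
      \<not> (P x y \<and> P y z \<and> P z x)"
    and neg: "\<And>x y z. x < d \<Longrightarrow> y < d \<Longrightarrow> z < d \<Longrightarrow> \<not> (x = y \<and> y = z) \<Longrightarrow>
      P x y \<or> P y z \<or> P z x"
  obtains x where "x < d" "\<And>y. y < d \<Longrightarrow> y \<noteq> x \<Longrightarrow> P x y \<and> \<not> P y x"
  | x y where "x < d" "y < d" "x \<noteq> y" "P x y = P y x"
    "\<And>z. z < d \<Longrightarrow> z \<noteq> x \<Longrightarrow> z \<noteq> y \<Longrightarrow> (P x z \<and> \<not> P z x) \<and> (P y z \<and> \<not> P z y)"
proof -
  define above where "above x y \<longleftrightarrow> P x y \<and> \<not> P y x" for x y
  define tied where "tied x y \<longleftrightarrow> x \<noteq> y \<and> (P x y \<longleftrightarrow> P y x)" for x y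
  have tri: "above x y \<or> above y x \<or> tied x y" if "x \<noteq> y" for x y
    using that by (auto simp: above_def tied_def)
  have diag: "P x x \<longleftrightarrow> \<not> P x y" "P y y \<longleftrightarrow> \<not> P x y" if "tied x y" "x < d" "y < d" for x y
    using that pos[of x x y] neg[of x x y] pos[of y y x] neg[of y y x] by (auto simp: tied_def)
  have tied_unique: "y = z" if t: "tied x y" "tied x z" and r: "x < d" "y < d" "z < d" for x y z
  proof (rule ccontr)
    \<comment> \<open>Triangles \<open>xyz\<close> and \<open>xzy\<close> give \<open>P y z\<close> and \<open>P z y\<close> the value of \<open>P y y\<close>; so \<open>yyz\<close> is constant.\<close>
    assume "y \<noteq> z"
    then show False
      using diag[OF t(1) r(1,2)] diag[OF t(2) r(1,3)] t
        pos[OF r(1,2,3)] neg[OF r(1,2,3)] pos[OF r(1,3,2)] neg[OF r(1,3,2)]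
        pos[OF r(2,2,3)] neg[OF r(2,2,3)]
      unfolding tied_def by metis
  qed
  have tied_sym: "tied x y \<Longrightarrow> tied y x" for x y by (auto simp: tied_def)
  have tied_above: "above z y" if "tied x y" "above z x" "z \<noteq> y" "x < d" "y < d" "z < d" for x y z
  proof -
    have "\<not> tied y z" using tied_unique[of y x z] tied_sym that by (auto simp: above_def)
    moreover have "\<not> above y z"
      using that pos[of y z x] neg[of x z y] by (auto simp: above_def tied_def)
    ultimately show ?thesis using tri[of y z] that(3) by auto
  qed
  have trans: "above x z" if "above x y" "above y z" "x < d" "y < d" "z < d" for x y z
  proof -
    have "\<not> P z x" using that pos[of x y z] by (auto simp: above_def)
    moreover have "\<not> tied z x"
      using tied_above[of z x y] that by (auto simp: above_def)
    ultimately show ?thesis using that by (auto simp: above_def tied_def)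
  qed
  have "asymp_on {..<d} above" by (rule asymp_onI) (auto simp: above_def)
  moreover have "transp_on {..<d} above"
  proof (rule transp_onI)
    fix x y z assume "x \<in> {..<d}" "y \<in> {..<d}" "z \<in> {..<d}" "above x y" "above y z"
    then show "above x z" using trans[of x y z] by simp
  qed
  moreover have "{..<d} \<noteq> {}" using d by blast
  ultimately have "\<exists>m\<in>{..<d}. \<forall>x\<in>{..<d}. x \<noteq> m \<longrightarrow> \<not> above x m"
    by (intro Finite_Set.bex_min_element) simp_all
  then obtain x where x: "x < d" and max: "\<And>y. y < d \<Longrightarrow> \<not> above y x"
    by (metis above_def lessThan_iff)
  show thesis
  proof (cases "\<exists>y<d. tied x y")
    case False
    then have "above x y" if "y < d" "y \<noteq> x" for y using tri[of x y] max that by blast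
    then show thesis using that(1)[of x] x by (auto simp: above_def)
  next
    case True
    then obtain y where y: "y < d" "tied x y" by blast
    have "above x z \<and> above y z" if z: "z < d" "z \<noteq> x" "z \<noteq> y" for z
    proof
      show "above x z" using tri[of x z] max z tied_unique[OF y(2)] x y by blast
      have "\<not> above z y" using tied_above[OF tied_sym[OF y(2)], of z] max z x y by blast
      moreover have "\<not> tied y z" using tied_unique[OF tied_sym[OF y(2)]] z x y by blast
      ultimately show "above y z" using tri[of y z] z by blast
    qed
    then show thesis using that(2)[of x y] x y by (auto simp: above_def tied_def)
  qed
qed

text \<open>A maximal letter of the order is not dominating here, so there is a tied pair above all other
  letters. The tie \<open>P x y = P y x\<close> fixes the words over \<open>{x, y}\<close>: if the common value is false, then
  \<open>P x x\<close> and \<open>P y y\<close> hold and the words are \<open>xxy, yyx\<close>; otherwise they are \<open>xyy, yxx\<close>.\<close>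

lemma LMIS_top:
  assumes d: "d > 0" and "is_LMIS d S" and none: "\<not> (\<exists>x. dominating d S x)"
  obtains x y b where "x < y" "S \<inter> cube x y = plain_part b x y" "core d x y (S - cube x y)"
proof -
  have S: "loop_free_indep d S" and m: "missed d S = {}" using assms is_LMIS_iff by auto
  define P where "P a b \<longleftrightarrow> (\<exists>c. (a, b, c) \<in> S)" for a b
  have SP: "P a b \<and> \<not> P b c" if "(a, b, c) \<in> S" for a b c
    using that loop_free_indepD[OF S that] by (auto simp: P_def)
  have PS: "(a, b, c) \<in> S" if "P a b" "\<not> P b c" "a < d" "b < d" "c < d" for a b c
  proof -
    have "\<not> (a = b \<and> b = c)" using that by auto
    then show ?thesis using unmissed[OF m that(3-5)] SP that by blast
  qed
  have pos: "\<not> (P x y \<and> P y z \<and> P z x)" and neg: "P x y \<or> P y z \<or> P z x"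
    if "x < d" "y < d" "z < d" "\<not> (x = y \<and> y = z)" for x y z
    using unmissed[OF m that] SP by blast+
  obtain x y where xy: "x < d" "y < d" "x \<noteq> y" and t: "P x y = P y x"
    and Z: "\<And>z. z < d \<Longrightarrow> z \<noteq> x \<Longrightarrow> z \<noteq> y \<Longrightarrow> (P x z \<and> \<not> P z x) \<and> (P y z \<and> \<not> P z y)"
  proof (rule top_letter_or_pair[OF d pos neg])
    fix x assume "x < d" "\<And>y. y < d \<Longrightarrow> y \<noteq> x \<Longrightarrow> P x y \<and> \<not> P y x"
    then have "dominating d S x" using PS by (auto simp: dominating_def)
    then show thesis using none by blast
  qed (use that in blast)+
  \<comment> \<open>The pair is unordered; fixing \<open>x < y\<close> makes its representation unique.\<close>
  have "\<exists>x y. x < y \<and> y < d \<and> P x y = P y x \<and> (\<forall>z. z < d \<longrightarrow> z \<noteq> x \<longrightarrow> z \<noteq> y \<longrightarrow>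
      (P x z \<and> \<not> P z x) \<and> (P y z \<and> \<not> P z y))"
    using xy t Z by (metis linorder_neq_iff)
  then obtain x y where xy: "x < y" "y < d" and t: "P x y = P y x"
    and Z: "\<And>z. z < d \<Longrightarrow> z \<noteq> x \<Longrightarrow> z \<noteq> y \<Longrightarrow> (P x z \<and> \<not> P z x) \<and> (P y z \<and> \<not> P z y)"
    by blast
  have xd: "x < d" using xy by simp
  have diag: "P x x \<longleftrightarrow> \<not> P x y" "P y y \<longleftrightarrow> \<not> P x y"
    using t xy xd pos[of x x y] neg[of x x y] pos[of y y x] neg[of y y x] by auto
  define b where "b \<longleftrightarrow> \<not> P x y"
  have sub: "plain_part b x y \<subseteq> S"
    using diag t PS xy xd by (cases b) (auto simp: b_def)
  have cube: "S \<inter> cube x y = plain_part b x y"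
  proof
    show "plain_part b x y \<subseteq> S \<inter> cube x y"
      by (intro Int_greatest sub parts_subset_cube)
    show "S \<inter> cube x y \<subseteq> plain_part b x y"
      using SP diag t by (cases b) (auto simp: cube_def b_def)
  qed
  have "card (S \<inter> cube x y) = 2" unfolding cube using xy by (cases b) auto
  then have "card S = card (S - cube x y) + 2"
    using card_Int_Diff[OF loop_free_indep_finite[OF S], of "cube x y"] by simp
  then have "3 * card (S - cube x y) + 6 = card (nonconst d)"
    using card_missed[OF S] m by simp
  moreover have "loop_free_indep d (S - cube x y)" using S unfolding loop_free_indep_def by blast
  moreover have "(x, z, x) \<in> S - cube x y \<and> (y, z, y) \<in> S - cube x y"
    if "z < d" "z \<noteq> x" "z \<noteq> y" for z
    using PS Z[OF that] that xy xd by (auto simp: cube_def)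
  ultimately have "core d x y (S - cube x y)" using xy xd by (auto simp: core_def)
  then show thesis using that xy(1) cube by blast
qed

section \<open>Counting\<close>

text \<open>The common index set of both families: a core together with the choice of its completion.
  The condition \<open>x < y\<close> represents each pair of letters once.\<close>

definition cores :: "nat \<Rightarrow> ((nat \<times> nat \<times> (nat \<times> nat \<times> nat) set) \<times> bool) set" where
  "cores d = {(x, y, T). x < y \<and> core d x y T} \<times> UNIV"

text \<open>The pair \<open>{x, y}\<close> can be read off from a completed core \<open>S\<close>: for two different pairs there would
  be letters \<open>w\<close> in the first only and \<open>u\<close> in the second only, and \<open>S\<close> would contain both
  \<open>wuw\<close> and \<open>uwu\<close>, which are adjacent.\<close>

lemma plain_bij:
  assumes d: "d > 0"
  shows "bij_betw (\<lambda>((x, y, T), b). T \<union> plain_part b x y) (cores d)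
    {S. is_LMIS d S \<and> \<not> (\<exists>x. dominating d S x)}" (is "bij_betw ?f _ ?L")
  unfolding bij_betw_def
proof
  show "inj_on ?f (cores d)"
  proof (rule inj_onI)
    fix p q
    assume pq: "p \<in> cores d" "q \<in> cores d" "?f p = ?f q"
    obtain x y T b where p: "p = ((x, y, T), b)" by (metis prod.exhaust)
    obtain x' y' T' b' where q: "q = ((x', y', T'), b')" by (metis prod.exhaust)
    have eq: "T \<union> plain_part b x y = T' \<union> plain_part b' x' y'" using pq(3) p q by simp
    have T: "core d x y T" "core d x' y' T'" and lt: "x < y" "x' < y'"
      using pq(1,2) p q by (auto simp: cores_def)
    define S where "S = T \<union> plain_part b x y"
    have S: "loop_free_indep d S" using core_extend(1)[OF T(1)] by (simp add: S_def)
    have Z: "(u, z, u) \<in> S" if "z < d" "z \<notin> {x, y}" "u \<in> {x, y}" for u z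
      using T that by (auto simp: S_def core_def)
    have Z': "(u, z, u) \<in> S" if "z < d" "z \<notin> {x', y'}" "u \<in> {x', y'}" for u z
      using T that eq by (auto simp: S_def core_def)
    have sub: "u \<notin> {x, y} \<Longrightarrow> u \<in> {x', y'} \<Longrightarrow> w \<in> {x, y} \<Longrightarrow> w \<in> {x', y'}" for u w
    proof (rule ccontr)
      assume u: "u \<notin> {x, y}" "u \<in> {x', y'}" and w: "w \<in> {x, y}" "w \<notin> {x', y'}"
      have "u < d" "w < d" using u w T by (auto simp: core_def)
      then have "(w, u, w) \<in> S" "(u, w, u) \<in> S" using Z[of u w] Z'[of w u] u w by simp_all
      then show False using loop_free_indepD[OF S] by blast
    qed
    have same: "x = x' \<and> y = y'"
    proof (cases "{x', y'} \<subseteq> {x, y}")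
      case False
      then obtain u where "u \<notin> {x, y}" "u \<in> {x', y'}" by blast
      then have "x \<in> {x', y'}" "y \<in> {x', y'}" using sub[of u x] sub[of u y] by simp_all
      then show ?thesis using lt by auto
    qed (use lt in auto)
    have "core d x y T'" "T \<union> plain_part b x y = T' \<union> plain_part b' x y"
      using T(2) eq same by simp_all
    from core_union_inject[OF T(1) this(1) parts_subset_cube(1) parts_subset_cube(1) this(2)]
    have "T = T'" "plain_part b x y = plain_part b' x y" by simp_all
    then show "p = q"
      using p q same lt part_inject(1)[of x y b b'] by simp
  qed
  show "?f ` cores d = ?L"
  proof
    show "?f ` cores d \<subseteq> ?L"
      using core_LMIS core_not_dominating by (force simp: cores_def)
    show "?L \<subseteq> ?f ` cores d"
    proof safe
      fix S assume "is_LMIS d S" "\<not> (\<exists>x. dominating d S x)"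
      then obtain x y b where "x < y" "S \<inter> cube x y = plain_part b x y" "core d x y (S - cube x y)"
        using LMIS_top[OF d] by blast
      then show "S \<in> ?f ` cores d"
        by (intro image_eqI[of _ _ "((x, y, S - cube x y), b)"]) (auto simp: cores_def)
    qed
  qed
qed

text \<open>Here the pair \<open>{x, y}\<close> can be read off from the constant words.\<close>

lemma loop_bij:
  assumes d: "d > 0"
  shows "bij_betw (\<lambda>((x, y, T), b). T \<union> loop_part b x y) (cores d)
    {S. is_MIS d S \<and> card (loops S) = 2}" (is "bij_betw ?f _ ?M")
  unfolding bij_betw_def
proof
  show "inj_on ?f (cores d)"
  proof (rule inj_onI)
    fix p q
    assume pq: "p \<in> cores d" "q \<in> cores d" "?f p = ?f q"
    obtain x y T b where p: "p = ((x, y, T), b)" by (metis prod.exhaust)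
    obtain x' y' T' b' where q: "q = ((x', y', T'), b')" by (metis prod.exhaust)
    have eq: "T \<union> loop_part b x y = T' \<union> loop_part b' x' y'" using pq(3) p q by simp
    have T: "core d x y T" "core d x' y' T'" and lt: "x < y" "x' < y'"
      using pq(1,2) p q by (auto simp: cores_def)
    have "{x, y} = {x', y'}"
      using core_MIS(2)[OF T(1), of b] core_MIS(2)[OF T(2), of b'] eq by simp
    then have same: "x = x' \<and> y = y'" using lt by (auto simp: doubleton_eq_iff)
    have "core d x y T'" "T \<union> loop_part b x y = T' \<union> loop_part b' x y"
      using T(2) eq same by simp_all
    from core_union_inject[OF T(1) this(1) parts_subset_cube(2) parts_subset_cube(2) this(2)]
    have "T = T'" "loop_part b x y = loop_part b' x y" by simp_all
    then show "p = q"
      using p q same lt part_inject(2)[of x y b b'] by simp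
  qed
  show "?f ` cores d = ?M"
  proof
    show "?f ` cores d \<subseteq> ?M"
      using core_MIS by (fastforce simp: cores_def)
    show "?M \<subseteq> ?f ` cores d"
    proof safe
      fix S assume S: "is_MIS d S" "card (loops S) = 2"
      then obtain x y where l: "loops S = {x, y}" "x < y"
        by (metis card_2_iff insert_commute linorder_neq_iff)
      then obtain b where "S \<inter> cube x y = loop_part b x y" "core d x y (S - cube x y)"
        using two_loops_core[OF d S(1), of x y] by auto
      then show "S \<in> ?f ` cores d" using l(2)
        by (intro image_eqI[of _ _ "((x, y, S - cube x y), b)"]) (auto simp: cores_def)
    qed
  qed
qed

theorem theorem5p6:
  fixes d :: nat
  assumes "d > 0"
  shows "card {S. is_LMIS d S} = card {S. is_MIS d S}"
proof -
  let ?L1 = "{S. is_LMIS d S \<and> (\<exists>x. dominating d S x)}"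
  let ?L2 = "{S. is_LMIS d S \<and> \<not> (\<exists>x. dominating d S x)}"
  let ?M1 = "{S. is_MIS d S \<and> card (loops S) = 1}"
  let ?M2 = "{S. is_MIS d S \<and> card (loops S) = 2}"
  have "{S. is_LMIS d S} \<subseteq> Pow (words d)" "{S. is_MIS d S} \<subseteq> Pow (words d)"
    using is_MIS_iff[OF assms] loop_indep_words loop_free_indep_words is_LMIS_iff by blast+
  then have fin: "finite {S. is_LMIS d S}" "finite {S. is_MIS d S}"
    by (auto intro: finite_subset[of _ "Pow (words d)"])
  have L: "{S. is_LMIS d S} = ?L1 \<union> ?L2" by blast
  have M: "{S. is_MIS d S} = ?M1 \<union> ?M2"
    using loop_indep_bound(2) is_MIS_iff[OF assms] by auto
  have "card {S. is_LMIS d S} = card ?L1 + card ?L2"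
    using fin(1) unfolding L by (intro card_Un_disjoint) auto
  also have "card ?L1 = card ?M1"
    using bij_betw_same_card[OF one_loop_bij[OF assms]] by simp
  also have "card ?L2 = card ?M2"
    using bij_betw_same_card[OF plain_bij[OF assms]] bij_betw_same_card[OF loop_bij[OF assms]]
    by simp
  also have "card ?M1 + card ?M2 = card {S. is_MIS d S}"
    using fin(2) unfolding M by (intro card_Un_disjoint[symmetric]) auto
  finally show ?thesis .
qed

end
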